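(* Let $f\in\mathbb{C}[x_1,x_2]$ be a weighted homogeneous polynomial of weight $(w_1,w_2)\in\mathbb{N}^2$ and degree $d$ that defines an isolated hypersurface singularity (at the origin). Suppose that $d\ge 2w_1\ge 2w_2>0$. Let $n\ge 3$. Then the derivation algebra $\operatorname{Der}\big(\mathbb{C}[x_1,x_2]/\langle f,\mathcal{J}_n(f)\rangle\big)$ is non-negatively graded, i.e. there is no nonzero derivation of negative weight on $\mathbb{C}[x_1,x_2]/\langle f,\mathcal{J}_n(f)\rangle$.
   Context: $\mathbb{N}$ includes $0$. For $\gamma\in\mathbb{N}^2$, $|\gamma|=\gamma_1+\gamma_2$, $\gamma!=\gamma_1!\gamma_2!$. With $w=(w_1,w_2)$, a polynomial is weighted homogeneous of weight $w$ and degree $d$ if every monomial $x^\gamma$ occurring in it with nonzero coefficient satisfies $\gamma_1w_1+\gamma_2w_2=d$. That $f$ defines an isolated hypersurface singularity means that the origin is an isolated point of the singular locus $\{f=\partial f/\partial x_1=\partial f/\partial x_2=0\}$. Let $B=\{\beta\in\mathbb{N}^2 : 0\le|\beta|\le n-1\}$, $A_1=\{\alpha\in\mathbb{N}^2 : 1\le|\alpha|\le n\}$, and $M=\mathrm{Card}(B)=\frac{n(n+1)}{2}$. The Jacobian matrix of order $n$ of $f$ is $$\mathrm{Jac}_n(f)=\left(\frac{1}{(\alpha-\beta)!}\frac{\partial^{\alpha-\beta}(f)}{\partial x^{\alpha-\beta}}\right)_{\beta\in B,\ \alpha\in A_1},$$ with rows indexed by $B$ and columns by $A_1$ (each ordered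 increasingly by a graded lexicographical order with $x_1<x_2$), where the entry is $0$ whenever $\alpha_i<\beta_i$ for some $i$ (and is $f$ when $\alpha=\beta$). $\mathcal{J}_n(f)$ is the ideal generated by all maximal ($M\times M$) minors of $\mathrm{Jac}_n(f)$. The ideal $\langle f,\mathcal{J}_n(f)\rangle$ is weighted homogeneous with respect to $w$, so $T=\mathbb{C}[x_1,x_2]/\langle f,\mathcal{J}_n(f)\rangle$ inherits the grading $T=\bigoplus_{i=0}^tT_i$ in which $x_j$ has degree $w_j$; it is Artinian. $\operatorname{Der}(T)$ is the Lie algebra of $\mathbb{C}$-linear derivations $T\to T$, graded by $\operatorname{Der}(T)=\bigoplus_{k=-t}^tL_k$ with $L_k=\{D\in\operatorname{Der}(T) : D(T_i)\subset T_{i+k}\text{ for all }i\}$ (where $T_j=0$ for $j\notin\{0,\ldots,t\}$). Non-negatively graded means $L_k=0$ for all $k<0$. *)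

theory Defs
  imports
    "HOL-Analysis.Isolated"
    "HOL-Library.FuncSet"
    "HOL-Computational_Algebra.Polynomial"
    "HOL-Algebra.QuotRing"
    "HOL-Algebra.Algebraic_Closure_Type"
    "Jordan_Normal_Form.Determinant"
    "Jordan_Normal_Form.DL_Submatrix"
begin

text \<open>
  The ring of complex polynomials in \<open>x\<^sub>1, x\<^sub>2\<close> is represented as \<open>\<complex>[x\<^sub>1][x\<^sub>2]\<close>: the outer
  variable is \<open>x\<^sub>2\<close>, and the coefficient of \<open>x\<^sub>1\<^sup>i x\<^sub>2\<^sup>j\<close> in \<open>f\<close> is \<^term>\<open>coeff (coeff f j) i\<close>.
\<close>

type_synonym poly2 = "complex poly poly"

definition eval2 :: "poly2 \<Rightarrow> complex \<times> complex \<Rightarrow> complex" where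
  "eval2 f a = poly (poly f [:snd a:]) (fst a)"

definition D1 :: "poly2 \<Rightarrow> poly2" where
  "D1 f = map_poly pderiv f"

definition D2 :: "poly2 \<Rightarrow> poly2" where
  "D2 f = pderiv f"

definition const2 :: "complex \<Rightarrow> poly2" where
  "const2 c = [:[:c:]:]"

text \<open>The degree is an integer so that negative degrees make sense below: only \<open>0\<close> is
  weighted homogeneous of negative degree.\<close>

definition weighted_homogeneous :: "nat \<times> nat \<Rightarrow> int \<Rightarrow> poly2 \<Rightarrow> bool" where
  "weighted_homogeneous w d f \<longleftrightarrow>
     (\<forall>i j. coeff (coeff f j) i \<noteq> 0 \<longrightarrow> int (i * fst w + j * snd w) = d)"

definition sing_locus :: "poly2 \<Rightarrow> (complex \<times> complex) set" where
  "sing_locus f = {a. eval2 f a = 0 \<and> eval2 (D1 f) a = 0 \<and> eval2 (D2 f) a = 0}"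

definition isolated_singularity_at_origin :: "poly2 \<Rightarrow> bool" where
  "isolated_singularity_at_origin f \<longleftrightarrow> (0, 0) isolated_in sing_locus f"

definition divided_deriv :: "nat \<times> nat \<Rightarrow> poly2 \<Rightarrow> poly2" where
  "divided_deriv \<gamma> f =
     const2 (1 / (fact (fst \<gamma>) * fact (snd \<gamma>))) * ((D1 ^^ fst \<gamma>) ((D2 ^^ snd \<gamma>) f))"

text \<open>The \<open>\<gamma> \<in> \<nat>\<^sup>2\<close> with \<open>a \<le> |\<gamma>| < b\<close>, in increasing graded lexicographical order with
  \<open>x\<^sub>1 < x\<^sub>2\<close>, i.e. \<open>1, x\<^sub>1, x\<^sub>2, x\<^sub>1\<^sup>2, x\<^sub>1 x\<^sub>2, x\<^sub>2\<^sup>2, \<dots>\<close>\<close>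

definition multi_indices :: "nat \<Rightarrow> nat \<Rightarrow> (nat \<times> nat) list" where
  "multi_indices a b = concat (map (\<lambda>k. map (\<lambda>j. (k - j, j)) [0..<Suc k]) [a..<b])"

lemma set_multi_indices:
  "set (multi_indices a b) = {\<gamma>. a \<le> fst \<gamma> + snd \<gamma> \<and> fst \<gamma> + snd \<gamma> < b}"
  by (force simp: multi_indices_def simp del: upt_Suc)

lemma distinct_multi_indices: "distinct (multi_indices a b)"
  by (induction b) (auto simp: multi_indices_def distinct_map inj_on_def simp del: upt_Suc
      simp: upt_Suc_append[of a] upt_Suc[of a])

lemma length_multi_indices_0: "length (multi_indices 0 n) = n * (n + 1) div 2"
  by (induction n) (auto simp: multi_indices_def)

definition Jac :: "nat \<Rightarrow> poly2 \<Rightarrow> poly2 mat" where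
  "Jac n f =
     (let B = multi_indices 0 n; A1 = multi_indices 1 (Suc n) in
      mat (length B) (length A1) (\<lambda>(i, j).
        let \<beta> = B ! i; \<alpha> = A1 ! j in
        if fst \<beta> \<le> fst \<alpha> \<and> snd \<beta> \<le> snd \<alpha>
        then divided_deriv (fst \<alpha> - fst \<beta>, snd \<alpha> - snd \<beta>) f
        else 0))"

text \<open>For matrices with at least as many columns as rows, which is the case for \<^const>\<open>Jac\<close>.\<close>

definition maximal_minors :: "'a::comm_ring_1 mat \<Rightarrow> 'a set" where
  "maximal_minors A =
     {det (submatrix A UNIV J) | J. J \<subseteq> {..<dim_col A} \<and> card J = dim_row A}"

abbreviation P2 :: "poly2 ring" where
  "P2 \<equiv> ring_of_type_algebra"

definition J_ideal :: "nat \<Rightarrow> poly2 \<Rightarrow> poly2 set" where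
  "J_ideal n f = genideal P2 (maximal_minors (Jac n f))"

definition fJ_ideal :: "nat \<Rightarrow> poly2 \<Rightarrow> poly2 set" where
  "fJ_ideal n f = genideal P2 (insert f (J_ideal n f))"

definition T_ring :: "nat \<Rightarrow> poly2 \<Rightarrow> poly2 set ring" where
  "T_ring n f = P2 Quot fJ_ideal n f"

definition T_class :: "nat \<Rightarrow> poly2 \<Rightarrow> poly2 \<Rightarrow> poly2 set" where
  "T_class n f p = fJ_ideal n f +>\<^bsub>P2\<^esub> p"

text \<open>The piece \<open>T\<^sub>i\<close> for arbitrary \<open>i \<in> \<int>\<close>; it is \<open>0\<close> for \<open>i < 0\<close> and above the top degree.\<close>

definition T_graded :: "nat \<times> nat \<Rightarrow> nat \<Rightarrow> poly2 \<Rightarrow> int \<Rightarrow> poly2 set set" where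
  "T_graded w n f i = {T_class n f p | p. weighted_homogeneous w i p}"

text \<open>Derivations of a commutative ring \<open>A\<close> that is a \<open>k\<close>-algebra via \<open>\<iota> : k \<rightarrow> A\<close>. They are
  extensional functions, so that two derivations are equal iff they agree on \<^term>\<open>carrier A\<close>.\<close>

definition derivations :: "('k \<Rightarrow> 'a) \<Rightarrow> 'a ring \<Rightarrow> ('a \<Rightarrow> 'a) set" where
  "derivations \<iota> A = {D \<in> carrier A \<rightarrow>\<^sub>E carrier A.
     (\<forall>x\<in>carrier A. \<forall>y\<in>carrier A. D (x \<oplus>\<^bsub>A\<^esub> y) = D x \<oplus>\<^bsub>A\<^esub> D y) \<and>
     (\<forall>c. \<forall>x\<in>carrier A. D (\<iota> c \<otimes>\<^bsub>A\<^esub> x) = \<iota> c \<otimes>\<^bsub>A\<^esub> D x) \<and>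
     (\<forall>x\<in>carrier A. \<forall>y\<in>carrier A.
        D (x \<otimes>\<^bsub>A\<^esub> y) = (D x \<otimes>\<^bsub>A\<^esub> y) \<oplus>\<^bsub>A\<^esub> (x \<otimes>\<^bsub>A\<^esub> D y))}"

definition Der_T :: "nat \<Rightarrow> poly2 \<Rightarrow> (poly2 set \<Rightarrow> poly2 set) set" where
  "Der_T n f = derivations (\<lambda>c. T_class n f (const2 c)) (T_ring n f)"

definition Der_graded ::
    "nat \<times> nat \<Rightarrow> nat \<Rightarrow> poly2 \<Rightarrow> int \<Rightarrow> (poly2 set \<Rightarrow> poly2 set) set" where
  "Der_graded w n f k =
     {D \<in> Der_T n f. \<forall>i. D ` T_graded w n f i \<subseteq> T_graded w n f (i + k)}"

definition Der_T_zero :: "nat \<Rightarrow> poly2 \<Rightarrow> poly2 set \<Rightarrow> poly2 set" where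
  "Der_T_zero n f = (\<lambda>x\<in>carrier (T_ring n f). \<zero>\<^bsub>T_ring n f\<^esub>)"

definition Der_T_nonneg_graded :: "nat \<times> nat \<Rightarrow> nat \<Rightarrow> poly2 \<Rightarrow> bool" where
  "Der_T_nonneg_graded w n f \<longleftrightarrow> (\<forall>k<0. Der_graded w n f k = {Der_T_zero n f})"

end

theory Submission
  imports Defs "HOL-Analysis.Derivative"
begin

text \<open>
  Let \<open>M = n (n + 1) / 2\<close>. The column indices of \<open>Jac\<^sub>n(f)\<close> outside \<open>B\<close> are those of total degree
  \<open>n\<close>, whose weights add up to \<open>M (w\<^sub>1 + w\<^sub>2)\<close>. Hence every maximal minor is weighted homogeneous of
  degree \<open>M (d - w\<^sub>1 - w\<^sub>2)\<close> plus the weights of the \<open>n\<close> omitted columns, and this is at least \<open>d\<close>.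
  So no nonzero element of \<open>\<langle>f, J\<^sub>n(f)\<rangle>\<close> has degree below \<open>d\<close>.

  A derivation of weight \<open>k < 0\<close> lifts to \<open>D = g(x\<^sub>2) \<partial>\<^sub>1 + c \<partial>\<^sub>2\<close> with \<open>c\<close> constant, because
  \<open>w\<^sub>1 \<ge> w\<^sub>2\<close>. As \<open>D f\<close> lies in the ideal and has degree \<open>d + k\<close>, it vanishes. If \<open>D \<noteq> 0\<close>,
  then \<open>f\<close> and its first derivatives are constant, hence zero, along a curve through the origin
  (the integral curve of \<open>D\<close> if \<open>c \<noteq> 0\<close>, and the \<open>x\<^sub>1\<close>-axis otherwise), so the singularity is not
  isolated.
\<close>

subsection \<open>Weighted supports\<close>

definition wdeg :: "nat \<times> nat \<Rightarrow> nat \<times> nat \<Rightarrow> nat" where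
  "wdeg w \<gamma> = fst \<gamma> * fst w + snd \<gamma> * snd w"

text \<open>A set of degrees covers homogeneity, with \<open>{e}\<close>, and order at least
  \<open>e\<close>, with \<open>{e..}\<close>, by one calculus. Degrees are integers since
  differentiation and a negative weight \<open>k\<close> can push them below 0.\<close>

definition wsupp :: "nat \<times> nat \<Rightarrow> int set \<Rightarrow> poly2 \<Rightarrow> bool" where
  "wsupp w S p \<longleftrightarrow> (\<forall>i j. coeff (coeff p j) i \<noteq> 0 \<longrightarrow> int (wdeg w (i, j)) \<in> S)"

lemma wdeg_add: "wdeg w (i + k, j + l) = wdeg w (i, j) + wdeg w (k, l)"
  by (simp add: wdeg_def algebra_simps)

lemma weighted_homogeneous_eq_wsupp: "weighted_homogeneous w e p \<longleftrightarrow> wsupp w {e} p"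
  by (simp add: weighted_homogeneous_def wsupp_def wdeg_def)

lemma wsupp_mono: "wsupp w S p \<Longrightarrow> S \<subseteq> S' \<Longrightarrow> wsupp w S' p"
  by (auto simp: wsupp_def)

lemma wsupp_0 [simp]: "wsupp w S 0"
  by (simp add: wsupp_def)

lemma wsupp_disjoint:
  assumes "wsupp w S p" "wsupp w S' p" "S \<inter> S' = {}"
  shows "p = 0"
  using assms by (intro poly_eqI) (fastforce simp: wsupp_def)

lemma wsupp_add:
  assumes "wsupp w S p" "wsupp w S q"
  shows "wsupp w S (p + q)"
proof -
  have "coeff (coeff p j) i \<noteq> 0 \<or> coeff (coeff q j) i \<noteq> 0"
    if "coeff (coeff (p + q) j) i \<noteq> 0" for i j
    using that by auto
  then show ?thesis
    using assms unfolding wsupp_def by blast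
qed

lemma wsupp_uminus: "wsupp w S p \<Longrightarrow> wsupp w S (- p)"
  by (simp add: wsupp_def)

lemma wsupp_sum: "(\<And>x. x \<in> A \<Longrightarrow> wsupp w S (g x)) \<Longrightarrow> wsupp w S (sum g A)"
  by (induction A rule: infinite_finite_induct) (auto intro: wsupp_add)

text \<open>A nonzero coefficient of the product comes from a pair of nonzero coefficients whose
  weights add up. \<open>S''\<close> is kept free to serve both singletons and up-sets.\<close>

lemma wsupp_mult:
  assumes p: "wsupp w S p" and q: "wsupp w S' q"
    and sub: "\<And>s s'. s \<in> S \<Longrightarrow> s' \<in> S' \<Longrightarrow> s + s' \<in> S''"
  shows "wsupp w S'' (p * q)"
  unfolding wsupp_def
proof (intro allI impI)
  fix i j assume nz: "coeff (coeff (p * q) j) i \<noteq> 0"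
  have "coeff (coeff (p * q) j) i =
      (\<Sum>l\<le>j. \<Sum>k\<le>i. coeff (coeff p l) k * coeff (coeff q (j - l)) (i - k))"
    by (simp add: coeff_mult coeff_sum)
  then obtain l where l: "l \<le> j"
      "(\<Sum>k\<le>i. coeff (coeff p l) k * coeff (coeff q (j - l)) (i - k)) \<noteq> 0"
    using nz by (metis (no_types, lifting) atMost_iff sum.neutral)
  then obtain k where k: "k \<le> i" "coeff (coeff p l) k * coeff (coeff q (j - l)) (i - k) \<noteq> 0"
    by (metis (no_types, lifting) atMost_iff sum.neutral)
  have "int (wdeg w (k, l)) + int (wdeg w (i - k, j - l)) \<in> S''"
    using k p q by (intro sub) (auto simp: wsupp_def)
  moreover have "wdeg w (k, l) + wdeg w (i - k, j - l) = wdeg w (i, j)"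
    using k(1) l(1) by (simp flip: wdeg_add)
  ultimately show "int (wdeg w (i, j)) \<in> S''"
    by (metis of_nat_add)
qed

lemma wsupp_const2: "wsupp w {0} (const2 c)"
  by (auto simp: wsupp_def const2_def wdeg_def coeff_pCons split: nat.splits)

lemma const2_1: "const2 1 = 1"
  by (simp add: const2_def one_pCons)

lemma wsupp_1: "wsupp w {0} 1"
  using wsupp_const2[of w 1] by (simp add: const2_1)

lemma wsupp_prod:
  assumes "\<And>x. x \<in> A \<Longrightarrow> wsupp w {s x} (g x)"
  shows "wsupp w {\<Sum>x\<in>A. s x} (\<Prod>x\<in>A. g x)"
  using assms
proof (induction A rule: infinite_finite_induct)
  case (insert x A)
  then show ?case
    by (auto intro!: wsupp_mult[where S = "{s x}" and S' = "{sum s A}"])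
qed (auto intro: wsupp_1)

section \<open>Degrees of partial derivatives and determinants\<close>

lemma coeff_D1: "coeff (coeff (D1 p) j) i = of_nat (Suc i) * coeff (coeff p j) (Suc i)"
  by (simp add: D1_def coeff_map_poly coeff_pderiv)

lemma coeff_D2: "coeff (coeff (D2 p) j) i = of_nat (Suc j) * coeff (coeff p (Suc j)) i"
proof -
  have "(of_nat m :: complex poly) = [:of_nat m:]" for m
    by (simp add: of_nat_poly)
  then show ?thesis
    by (simp only: D2_def coeff_pderiv) simp
qed

lemma wsupp_D1: "wsupp w {e} p \<Longrightarrow> wsupp w {e - int (fst w)} (D1 p)"
  unfolding wsupp_def coeff_D1
  by (intro allI impI) (drule_tac x = "Suc i" in spec, drule_tac x = j in spec, auto simp: wdeg_def)

lemma wsupp_D2: "wsupp w {e} p \<Longrightarrow> wsupp w {e - int (snd w)} (D2 p)"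
  unfolding wsupp_def coeff_D2
  by (intro allI impI) (drule_tac x = i in spec, drule_tac x = "Suc j" in spec, auto simp: wdeg_def)

lemma wsupp_funpow_D1: "wsupp w {e} p \<Longrightarrow> wsupp w {e - int (m * fst w)} ((D1 ^^ m) p)"
proof (induction m)
  case (Suc m)
  then show ?case
    using wsupp_D1[of w "e - int (m * fst w)" "(D1 ^^ m) p"] by (simp add: algebra_simps)
qed simp

lemma wsupp_funpow_D2: "wsupp w {e} p \<Longrightarrow> wsupp w {e - int (m * snd w)} ((D2 ^^ m) p)"
proof (induction m)
  case (Suc m)
  then show ?case
    using wsupp_D2[of w "e - int (m * snd w)" "(D2 ^^ m) p"] by (simp add: algebra_simps)
qed simp

lemma wsupp_divided_deriv:
  assumes "wsupp w {e} p"
  shows "wsupp w {e - int (wdeg w \<gamma>)} (divided_deriv \<gamma> p)"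
  unfolding divided_deriv_def
  by (rule wsupp_mult[OF wsupp_const2 wsupp_funpow_D1[OF wsupp_funpow_D2[OF assms]]])
    (simp add: wdeg_def)

text \<open>Each Leibniz term uses every row and every column once, so all terms have the same
  degree, whatever the permutation.\<close>

lemma wsupp_det:
  assumes A: "A \<in> carrier_mat m m"
    and entries: "\<And>i j. i < m \<Longrightarrow> j < m \<Longrightarrow> wsupp w {a i - b j} (A $$ (i, j))"
  shows "wsupp w {(\<Sum>i<m. a i) - (\<Sum>j<m. b j)} (det A)"
  unfolding det_def'[OF A]
proof (rule wsupp_sum, clarsimp)
  fix p assume p: "p permutes {0..<m}"
  have "wsupp w {\<Sum>i = 0..<m. a i - b (p i)} (\<Prod>i = 0..<m. A $$ (i, p i))"
    using p by (intro wsupp_prod entries) (auto simp: permutes_in_image)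
  moreover have "(\<Sum>i = 0..<m. b (p i)) = (\<Sum>i = 0..<m. b i)"
    using sum.permute[OF p, of b] by (simp add: comp_def)
  ultimately have "wsupp w {(\<Sum>i<m. a i) - (\<Sum>j<m. b j)} (\<Prod>i = 0..<m. A $$ (i, p i))"
    by (simp add: sum_subtractf atLeast0LessThan)
  moreover have "signof p = (1 :: poly2) \<or> signof p = (- 1 :: poly2)"
    by (simp add: sign_def)
  ultimately show "wsupp w {(\<Sum>i<m. a i) - (\<Sum>j<m. b j)} (signof p * (\<Prod>i = 0..<m. A $$ (i, p i)))"
    by (auto intro: wsupp_uminus)
qed

subsection \<open>Degrees of the maximal minors\<close>

text \<open>On the level of total degree k, the reflection of j to k - j shows that both coordinates
  have sum k(k+1)/2. The factor 2 avoids division.\<close>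

lemma sum_list_wdeg_multi_indices:
  "2 * sum_list (map (wdeg w) (multi_indices a b)) =
     (\<Sum>k=a..<b. k * (k + 1)) * (fst w + snd w)"
proof -
  have level: "2 * (\<Sum>j<Suc k. wdeg w (k - j, j)) = k * (k + 1) * (fst w + snd w)" for k
  proof -
    have "(\<Sum>j<Suc k. wdeg w (k - j, j)) =
        (\<Sum>j<Suc k. k - j) * fst w + (\<Sum>j<Suc k. j) * snd w"
      by (simp add: wdeg_def sum.distrib sum_distrib_right del: sum.lessThan_Suc)
    also have "(\<Sum>j<Suc k. k - j) = (\<Sum>j<Suc k. j)"
      using sum.nat_diff_reindex[of "\<lambda>j. j" "Suc k"] by simp
    finally have "2 * (\<Sum>j<Suc k. wdeg w (k - j, j)) = 2 * (\<Sum>j<Suc k. j) * (fst w + snd w)"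
      by (simp only: add_mult_distrib2 mult.assoc)
    also have "2 * (\<Sum>j<Suc k. j) = k * (k + 1)"
      using gauss_sum_nat[of k] by (simp add: lessThan_Suc_atMost atLeast0AtMost)
    finally show ?thesis .
  qed
  have "sum_list (map h (concat xss)) = sum_list (map (\<lambda>xs. sum_list (map h xs)) xss)"
    for h :: "nat \<times> nat \<Rightarrow> nat" and xss
    by (induction xss) auto
  then have "sum_list (map (wdeg w) (multi_indices a b)) =
      (\<Sum>k=a..<b. \<Sum>j<Suc k. wdeg w (k - j, j))"
    by (simp add: multi_indices_def comp_def
        interv_sum_list_conv_sum_set_nat atLeast0LessThan del: upt_Suc)
  then show ?thesis
    by (simp only:) (subst sum_distrib_left, simp only: level sum_distrib_right)
qed

lemma length_multi_indices: "length (multi_indices a b) = (\<Sum>k=a..<b. Suc k)"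
  by (simp add: multi_indices_def length_concat comp_def interv_sum_list_conv_sum_set_nat)

text \<open>Passing from B to the column indices drops (0,0) and adds the n + 1 indices of total
  degree n. Hence a maximal minor omits exactly n columns.\<close>

lemma length_multi_indices_Suc:
  "length (multi_indices (Suc 0) (Suc n)) = length (multi_indices 0 n) + n"
  by (induction n) (simp_all add: length_multi_indices)

text \<open>The left-hand side is the degree of the minor with columns \<open>J\<close>. It equals
  m(d - w1 - w2) plus the weight of the omitted columns \<open>K\<close>, where m is the number of
  rows.\<close>

lemma minor_degree_bound:
  fixes w1 w2 d n :: nat
  defines "B \<equiv> multi_indices 0 n" and "A \<equiv> multi_indices 1 (Suc n)"
  assumes J: "J \<subseteq> {..<length A}" "card J = length B"
    and d: "d \<ge> 2 * w1" and w: "w1 \<ge> w2" and n: "n \<ge> 3"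
  shows "(\<Sum>i<length B. int d + int (wdeg (w1, w2) (B ! i)))
           - (\<Sum>j\<in>J. int (wdeg (w1, w2) (A ! j))) \<ge> int d"
proof -
  define h where "h = wdeg (w1, w2)"
  define m where "m = length B"
  have m: "2 * m = n * (n + 1)"
    by (simp add: m_def B_def length_multi_indices_0)
  have m6: "m \<ge> 6"
    using m n mult_le_mono[OF n, of 4 "n + 1"] by simp
  have list_sum: "(\<Sum>i<length xs. h (xs ! i)) = sum_list (map h xs)" for xs
    by (simp add: sum_list_sum_nth atLeast0LessThan)
  have "2 * sum_list (map h A) = 2 * sum_list (map h B) + n * (n + 1) * (w1 + w2)"
  proof -
    \<comment> \<open>The level k = 0 contributes nothing, so the two sums differ only by level
      n.\<close>
    have "(\<Sum>k=1..<Suc n. k * (k + 1)) = (\<Sum>k=0..<n. k * (k + 1)) + n * (n + 1)"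
      using n by (simp add: sum.atLeast_Suc_lessThan[of 0 n])
    then show ?thesis
      by (simp only: h_def A_def B_def sum_list_wdeg_multi_indices fst_conv snd_conv add_mult_distrib)
  qed
  then have A: "sum_list (map h A) = sum_list (map h B) + m * (w1 + w2)"
    by (simp only: add_mult_distrib flip: m)
  define K where "K = {..<length A} - J"
  have "card K = n"
    using J by (simp add: K_def card_Diff_subset finite_subset[OF J(1)] A_def B_def
        length_multi_indices_Suc)
  moreover have "w2 \<le> h (A ! j)" if "j \<in> K" for j
  proof -
    have "A ! j \<in> set A"
      using that by (simp add: K_def)
    then have "fst (A ! j) \<ge> 1 \<or> snd (A ! j) \<ge> 1"
      by (auto simp: A_def set_multi_indices)
    moreover have "w2 \<le> x * w1 + y * w2" if "x \<ge> 1 \<or> y \<ge> 1" for x y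
      using that w by (cases x; cases y) auto
    ultimately show ?thesis
      by (simp add: h_def wdeg_def)
  qed
  ultimately have K: "n * w2 \<le> (\<Sum>j\<in>K. h (A ! j))"
    using sum_bounded_below[of K w2 "\<lambda>j. h (A ! j)"] by simp
  have "(\<Sum>j\<in>J. h (A ! j)) + (\<Sum>j\<in>K. h (A ! j)) = sum_list (map h A)"
    using sum.subset_diff[OF J(1), of "\<lambda>j. h (A ! j)"] by (simp add: K_def list_sum)
  then have J': "(\<Sum>j\<in>J. h (A ! j)) + n * w2 \<le> sum_list (map h B) + m * (w1 + w2)"
    using A K by linarith
  \<comment> \<open>As d \<ge> w1 + w2, the factor is nonnegative and m may be lowered to 6. With 3
    w2 from the omitted columns, 5d \<ge> 6 w1 + 3 w2 remains, which follows from d \<ge> 2 w1 \<ge>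
    2 w2.\<close>
  have "int m * (int d - int w1 - int w2) \<ge> 6 * (int d - int w1 - int w2)"
    using m6 d w by (intro mult_right_mono) auto
  moreover have "3 * int w2 \<le> int n * int w2"
    using n by (intro mult_right_mono) auto
  ultimately have "int d + int m * (int w1 + int w2) \<le> int m * int d + int (n * w2)"
    using d w by (simp add: algebra_simps)
  moreover have "int (\<Sum>j\<in>J. h (A ! j)) + int (n * w2)
      \<le> int (sum_list (map h B)) + int m * (int w1 + int w2)"
    using J' by (metis of_nat_add of_nat_le_iff of_nat_mult)
  moreover have "(\<Sum>i<length B. int d + int (h (B ! i))) = int m * int d + int (sum_list (map h B))"
    by (simp add: sum.distrib m_def flip: list_sum)
  ultimately show ?thesis
    unfolding h_def[symmetric] by simp
qed

text \<open>Turns sums over the column numbers of a submatrix into sums over the selected set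
  \<open>J\<close>.\<close>

lemma bij_betw_pick:
  assumes "finite J"
  shows "bij_betw (pick J) {..<card J} J"
proof -
  have inj: "inj_on (pick J) {..<card J}"
    by (rule inj_onI) (metis lessThan_iff linorder_neqE_nat nat_neq_iff pick_mono_le)
  moreover have "pick J ` {..<card J} = J"
    using assms card_image[OF inj]
    by (intro card_subset_eq) (auto simp: pick_in_set_le)
  ultimately show ?thesis
    by (simp add: bij_betw_def)
qed

text \<open>Differentiating by \<alpha> - \<beta> lowers the degree by its weight. The entries set
  to 0 fit too, since 0 is homogeneous of every degree.\<close>

lemma wsupp_Jac:
  fixes f :: poly2
  assumes "wsupp w {e} f" "i < dim_row (Jac n f)" "j < dim_col (Jac n f)"
  shows "wsupp w {e + int (wdeg w (multi_indices 0 n ! i)) - int (wdeg w (multi_indices 1 (Suc n) ! j))}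
           (Jac n f $$ (i, j))"
proof -
  define \<beta> where "\<beta> = multi_indices 0 n ! i"
  define \<alpha> where "\<alpha> = multi_indices 1 (Suc n) ! j"
  have entry: "Jac n f $$ (i, j) = (if fst \<beta> \<le> fst \<alpha> \<and> snd \<beta> \<le> snd \<alpha>
      then divided_deriv (fst \<alpha> - fst \<beta>, snd \<alpha> - snd \<beta>) f else 0)"
    using assms(2,3) by (simp add: Jac_def Let_def \<alpha>_def \<beta>_def)
  show ?thesis
  proof (cases "fst \<beta> \<le> fst \<alpha> \<and> snd \<beta> \<le> snd \<alpha>")
    case True
    then have "wdeg w \<alpha> = wdeg w \<beta> + wdeg w (fst \<alpha> - fst \<beta>, snd \<alpha> - snd \<beta>)"
      by (simp flip: wdeg_add[of w "fst \<beta>" _ "snd \<beta>", simplified])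
    then show ?thesis
      using True wsupp_divided_deriv[OF assms(1), of "(fst \<alpha> - fst \<beta>, snd \<alpha> - snd \<beta>)"]
      unfolding entry \<alpha>_def[symmetric] \<beta>_def[symmetric] by simp
  qed (use entry in auto)
qed

lemma wsupp_maximal_minors_Jac:
  assumes f: "wsupp (w1, w2) {int d} f" and g: "g \<in> maximal_minors (Jac n f)"
    and d: "d \<ge> 2 * w1" and w: "w1 \<ge> w2" and n: "n \<ge> 3"
  shows "wsupp (w1, w2) {int d..} g"
proof -
  define B where "B = multi_indices 0 n"
  define A where "A = multi_indices 1 (Suc n)"
  have dims: "dim_row (Jac n f) = length B" "dim_col (Jac n f) = length A"
    by (simp_all add: Jac_def Let_def A_def B_def)
  obtain J where J: "J \<subseteq> {..<length A}" "card J = length B"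
    and g: "g = det (submatrix (Jac n f) UNIV J)"
    using g by (auto simp: maximal_minors_def dims)
  \<comment> \<open>The set on the left is how the chosen columns appear in the dimension and index
    rules for \<open>submatrix\<close>.\<close>
  have J_eq: "{j. j < length A \<and> j \<in> J} = J"
    using J(1) by auto
  have bij: "bij_betw (pick J) {..<length B} J"
    using bij_betw_pick[OF finite_subset[OF J(1)]] J(2) by simp
  define S where "S = submatrix (Jac n f) UNIV J"
  have S: "S \<in> carrier_mat (length B) (length B)"
    unfolding S_def by (intro carrier_matI) (simp_all add: dim_submatrix dims J_eq J(2))
  have "wsupp (w1, w2) {(int d + int (wdeg (w1, w2) (B ! i))) - int (wdeg (w1, w2) (A ! pick J j))}
      (S $$ (i, j))" if "i < length B" "j < length B" for i j
  proof -
    have "S $$ (i, j) = Jac n f $$ (i, pick J j)"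
      using that unfolding S_def
      by (subst submatrix_index) (simp_all add: dims J_eq J(2) pick_UNIV)
    moreover have "pick J j < length A"
      using bij_betwE[OF bij] that J(1) by auto
    ultimately show ?thesis
      using wsupp_Jac[OF f, of i n "pick J j"] that by (simp add: dims A_def B_def)
  qed
  from wsupp_det[OF S this]
  have "wsupp (w1, w2) {(\<Sum>i<length B. int d + int (wdeg (w1, w2) (B ! i)))
      - (\<Sum>j\<in>J. int (wdeg (w1, w2) (A ! j)))} g"
    by (simp add: g S_def sum.reindex_bij_betw[OF bij, of "\<lambda>j. int (wdeg (w1, w2) (A ! j))"])
  then show ?thesis
    by (rule wsupp_mono) (use minor_degree_bound[OF J[unfolded A_def B_def] d w n] in
        \<open>simp add: A_def B_def\<close>)
qed

subsection \<open>Vector fields annihilating a polynomial\<close>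

lemma eval2_0 [simp]: "eval2 0 a = 0"
  by (simp add: eval2_def)

lemma eval2_pCons: "eval2 (pCons c p) a = poly c (fst a) + snd a * eval2 p a"
  by (simp add: eval2_def)

lemma eval2_add: "eval2 (p + q) a = eval2 p a + eval2 q a"
  by (simp add: eval2_def)

lemma eval2_mult: "eval2 (p * q) a = eval2 p a * eval2 q a"
  by (simp add: eval2_def)

lemma D1_0 [simp]: "D1 0 = 0"
  by (simp add: D1_def)

lemma D2_0 [simp]: "D2 0 = 0"
  by (simp add: D2_def)

lemma D1_pCons: "D1 (pCons c p) = pCons (pderiv c) (D1 p)"
  by (simp add: D1_def map_poly_pCons)

lemma D2_pCons: "D2 (pCons c p) = p + pCons 0 (D2 p)"
  by (simp add: D2_def pderiv_pCons)

lemma D1_add: "D1 (p + q) = D1 p + D1 q"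
  by (intro poly_eqI) (simp add: D1_def coeff_map_poly pderiv_add)

lemma D1_smult: "D1 (smult c p) = smult (pderiv c) p + smult c (D1 p)"
  by (intro poly_eqI) (simp add: D1_def coeff_map_poly pderiv_mult algebra_simps)

lemma D1_mult: "D1 (p * q) = D1 p * q + p * D1 q"
  by (induction p) (simp_all add: D1_add D1_smult D1_pCons algebra_simps)

lemma D1_D2: "D1 (D2 p) = D2 (D1 p)"
  by (induction p) (simp_all add: D1_add D1_pCons D2_pCons)

text \<open>The chain rule along a curve, by induction on the Horner form in the outer variable
  x2.\<close>

lemma has_field_derivative_eval2:
  assumes x: "(x has_field_derivative x') (at t)" and y: "(y has_field_derivative y') (at t)"
  shows "((\<lambda>t. eval2 p (x t, y t)) has_field_derivative
           (x' * eval2 (D1 p) (x t, y t) + y' * eval2 (D2 p) (x t, y t))) (at t)"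
proof (induction p)
  case (pCons c p)
  have c: "((\<lambda>t. poly c (x t)) has_field_derivative poly (pderiv c) (x t) * x') (at t)"
    by (rule DERIV_chain2[OF poly_DERIV x])
  show ?case
    unfolding eval2_pCons D1_pCons D2_pCons eval2_add fst_conv snd_conv
    by (rule DERIV_cong[OF DERIV_add[OF c DERIV_mult[OF y pCons.IH]]]) (simp add: algebra_simps)
qed simp

text \<open>Along the curve, the derivative of \<open>p\<close> is the value of the field applied to
  \<open>p\<close>, which is 0.\<close>

lemma eval2_const_on_integral_curve:
  fixes x y :: "complex \<Rightarrow> complex"
  assumes x: "\<And>t. (x has_field_derivative eval2 g1 (x t, y t)) (at t)"
    and y: "\<And>t. (y has_field_derivative eval2 g2 (x t, y t)) (at t)"
    and p: "g1 * D1 p + g2 * D2 p = 0"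
  shows "eval2 p (x t, y t) = eval2 p (x 0, y 0)"
proof -
  have "((\<lambda>t. eval2 p (x t, y t)) has_field_derivative 0) (at t)" for t
  proof -
    have "eval2 (g1 * D1 p + g2 * D2 p) (x t, y t) = 0"
      by (simp add: p)
    then show ?thesis
      using has_field_derivative_eval2[OF x[of t] y[of t], of p] by (simp add: eval2_add eval2_mult)
  qed
  then obtain c where "\<And>t. eval2 p (x t, y t) = c"
    using has_field_derivative_zero_constant[of UNIV "\<lambda>t. eval2 p (x t, y t)"] by auto
  then show ?thesis
    by simp
qed

text \<open>By continuity, every neighbourhood of the base point contains curve points with t
  \<noteq> 0; they lie in \<open>S\<close> and differ from the base point.\<close>

lemma not_isolated_in_if_on_curve:
  fixes x y :: "complex \<Rightarrow> complex"
  assumes cont: "isCont x 0" "isCont y 0"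
    and inj: "\<And>t. (x t, y t) = (x 0, y 0) \<Longrightarrow> t = 0"
    and S: "\<And>t. (x t, y t) \<in> S"
  shows "\<not> (x 0, y 0) isolated_in S"
proof
  assume "(x 0, y 0) isolated_in S"
  then obtain U where U: "open U" "U \<inter> S = {(x 0, y 0)}"
    by (auto simp: isolated_in_def)
  have "((\<lambda>t. (x t, y t)) \<longlongrightarrow> (x 0, y 0)) (at 0)"
    using cont by (intro tendsto_Pair) (auto simp: isCont_def)
  then have "\<forall>\<^sub>F t in at 0. (x t, y t) \<in> U"
    using U by (auto simp: tendsto_def)
  moreover have "\<forall>\<^sub>F t :: complex in at 0. t \<noteq> 0"
    by (rule eventually_neq_at_within)
  ultimately have "\<forall>\<^sub>F t in at (0 :: complex). False"
  proof eventually_elim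
    case (elim t)
    then show ?case
      using U(2) S[of t] inj[of t] by auto
  qed
  then show False
    by simp
qed

lemma poly_antiderivative_exists:
  fixes p :: "'a :: field_char_0 poly"
  obtains q where "pderiv q = p" "poly q 0 = 0"
proof
  define q where "q = (\<Sum>i\<le>degree p. monom (coeff p i / of_nat (Suc i)) (Suc i))"
  have "of_nat (Suc i) \<noteq> (0 :: 'a)" for i
    by (simp only: of_nat_eq_0_iff)
  moreover have "coeff q (Suc i) = coeff p i / of_nat (Suc i)" for i
    by (simp add: q_def coeff_sum coeff_eq_0 sum.delta del: of_nat_Suc)
  ultimately show "pderiv q = p"
    by (intro poly_eqI) (simp add: coeff_pderiv del: of_nat_Suc)
  show "poly q 0 = 0"
    by (simp add: q_def poly_sum poly_monom)
qed

text \<open>\<open>map_poly (\<lambda>a. [:a:]) g\<close> is g(x2) as an element of C[x1][x2]. For c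
  \<noteq> 0, the triangular shape of the field gives an explicit polynomial integral curve through
  the origin.\<close>

lemma annihilating_field_eq_0:
  fixes f :: poly2 and g :: "complex poly"
  assumes sing: "isolated_singularity_at_origin f"
    and Df: "map_poly (\<lambda>a. [:a:]) g * D1 f + const2 c * D2 f = 0"
  shows "g = 0 \<and> c = 0"
proof -
  have f0: "eval2 f (0, 0) = 0" "eval2 (D1 f) (0, 0) = 0" "eval2 (D2 f) (0, 0) = 0"
    using sing by (auto simp: isolated_singularity_at_origin_def isolated_in_def sing_locus_def)
  have eval_g: "eval2 (map_poly (\<lambda>a. [:a:]) g) (s, t) = poly g t" for s t
    by (induction g) (simp_all add: eval2_pCons map_poly_pCons)
  have eval_c: "eval2 (const2 c) a = c" for a
    by (simp add: const2_def eval2_pCons)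
  show ?thesis
  proof (cases "c = 0")
    case True
    have "g = 0"
    proof (rule ccontr)
      assume "g \<noteq> 0"
      then have "map_poly (\<lambda>a. [:a:]) g \<noteq> 0"
        by (simp add: map_poly_eq_0_iff)
      \<comment> \<open>C[x1][x2] is an integral domain, so g(x2) cancels.\<close>
      then have D1f: "D1 f = 0"
        using Df True by (simp add: const2_def)
      have "(t, 0) \<in> sing_locus f" for t
      proof -
        \<comment> \<open>The x1-axis is the integral curve of the constant field with components 1
          and 0. \<open>D2 f\<close> qualifies as \<open>p\<close> because the partial derivatives
          commute.\<close>
        have "eval2 p (t, 0) = eval2 p (0, 0)" if "D1 p = 0" for p
          by (rule eval2_const_on_integral_curve[of "\<lambda>t. t" 1 "\<lambda>t. 0" 0])
            (use that in \<open>auto simp: eval2_def\<close>)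
        from this[of f] this[of "D2 f"] show ?thesis
          using D1f f0 by (simp add: sing_locus_def D1_D2)
      qed
      then show False
        using not_isolated_in_if_on_curve[of "\<lambda>t. t" "\<lambda>t. 0" "sing_locus f"] sing
        by (simp add: isolated_singularity_at_origin_def)
    qed
    with True show ?thesis
      by simp
  next
    case False
    obtain q where q: "pderiv q = smult (1 / c) g" "poly q 0 = 0"
      using poly_antiderivative_exists by metis
    \<comment> \<open>Solves y' = c, x' = g(y) from the origin: the factor c of the chain rule
      cancels the 1/c in q' = g/c.\<close>
    define x where "x = (\<lambda>t. poly q (c * t))"
    define y where "y = (\<lambda>t. c * t)"
    define G where "G = map_poly (\<lambda>a. [:a:]) g"
    have xy0: "x 0 = 0" "y 0 = 0"
      by (simp_all add: x_def y_def q)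
    have x: "(x has_field_derivative eval2 G (x t, y t)) (at t)" for t
    proof -
      have "(x has_field_derivative poly (pderiv q) (c * t) * c) (at t)"
        unfolding x_def by (rule DERIV_chain2[OF poly_DERIV]) (auto intro!: derivative_eq_intros)
      then show ?thesis
        using False by (simp add: q G_def eval_g y_def)
    qed
    have y: "(y has_field_derivative eval2 (const2 c) (x t, y t)) (at t)" for t
      unfolding eval_c unfolding y_def by (auto intro!: derivative_eq_intros)
    \<comment> \<open>\<open>\<partial>\<^sub>1\<close> commutes with the field, as its coefficients do not involve \<open>x\<^sub>1\<close>.\<close>
    have D1G: "D1 G = 0" "D1 (const2 c) = 0"
      by (auto intro!: poly_eqI simp: G_def D1_def const2_def coeff_map_poly pderiv_pCons map_poly_pCons)
    have "G * D1 (D1 f) + const2 c * D2 (D1 f) = D1 (G * D1 f + const2 c * D2 f)"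
      by (simp add: D1_add D1_mult D1G D1_D2)
    then have DD1f: "G * D1 (D1 f) + const2 c * D2 (D1 f) = 0"
      using Df by (simp add: G_def)
    have "(x t, y t) \<in> sing_locus f" for t
    proof -
      have 1: "eval2 f (x t, y t) = 0"
        using eval2_const_on_integral_curve[OF x y Df[folded G_def]] f0 by (simp add: xy0)
      have 2: "eval2 (D1 f) (x t, y t) = 0"
        using eval2_const_on_integral_curve[OF x y DD1f] f0 by (simp add: xy0)
      \<comment> \<open>Where \<open>D1 f\<close> vanishes, the relation reduces to c times
        \<open>D2 f\<close> being 0, and c \<noteq> 0.\<close>
      have "eval2 (G * D1 f + const2 c * D2 f) (x t, y t) = 0"
        using Df by (simp add: G_def)
      then have "eval2 (D2 f) (x t, y t) = 0"
        using 2 False by (simp add: eval2_add eval2_mult eval_c)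
      with 1 2 show ?thesis
        by (simp add: sing_locus_def)
    qed
    moreover have "t = 0" if "(x t, y t) = (x 0, y 0)" for t
      using that False by (simp add: y_def)
    ultimately have "\<not> (x 0, y 0) isolated_in sing_locus f"
      by (intro not_isolated_in_if_on_curve DERIV_isCont[OF x] DERIV_isCont[OF y])
    then show ?thesis
      using sing by (simp add: isolated_singularity_at_origin_def xy0)
  qed
qed

subsection \<open>Derivations of the quotient\<close>

lemma P2_simps [simp]:
  "carrier P2 = UNIV" "p \<otimes>\<^bsub>P2\<^esub> q = p * q" "p \<oplus>\<^bsub>P2\<^esub> q = p + q" "\<zero>\<^bsub>P2\<^esub> = 0" "\<one>\<^bsub>P2\<^esub> = 1"
  by (simp_all add: ring_of_type_algebra_def)

lemma ideal_fJ_ideal: "ideal (fJ_ideal n f) P2"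
proof -
  interpret ring P2 by (rule ring_from_type_algebra)
  show ?thesis
    unfolding fJ_ideal_def by (rule genideal_ideal) simp
qed

lemma f_in_fJ_ideal: "f \<in> fJ_ideal n f"
  by (auto simp: fJ_ideal_def genideal_def)

lemma fJ_ideal_subset:
  assumes "ideal I P2" "f \<in> I" "maximal_minors (Jac n f) \<subseteq> I"
  shows "fJ_ideal n f \<subseteq> I"
  using assms by (auto simp: fJ_ideal_def J_ideal_def genideal_def)

lemma T_ring_simps [simp]:
  "T_class n f p \<otimes>\<^bsub>T_ring n f\<^esub> T_class n f q = T_class n f (p * q)"
  "T_class n f p \<oplus>\<^bsub>T_ring n f\<^esub> T_class n f q = T_class n f (p + q)"
  using ring_hom_mult[OF ideal.rcos_ring_hom[OF ideal_fJ_ideal[of n f]], of p q]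
    ring_hom_add[OF ideal.rcos_ring_hom[OF ideal_fJ_ideal[of n f]], of p q]
  by (simp_all add: T_class_def T_ring_def)

lemma carrier_T_ring: "carrier (T_ring n f) = range (T_class n f)"
  by (auto simp: T_ring_def T_class_def FactRing_def A_RCOSETS_def')

lemma T_class_eq_ideal_iff: "T_class n f p = fJ_ideal n f \<longleftrightarrow> p \<in> fJ_ideal n f"
proof -
  interpret ideal "fJ_ideal n f" P2 by (rule ideal_fJ_ideal)
  show ?thesis
    using a_rcos_const rcos_const_imp_mem[of p] by (auto simp: T_class_def)
qed

lemma T_class_0: "T_class n f 0 = fJ_ideal n f"
  using additive_subgroup.zero_closed[OF ideal.axioms(1)[OF ideal_fJ_ideal[of n f]]]
  by (simp add: T_class_eq_ideal_iff)

lemma zero_T_ring: "\<zero>\<^bsub>T_ring n f\<^esub> = T_class n f 0"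
  by (simp add: T_class_0) (simp add: T_ring_def FactRing_def)

section \<open>Derivations as vector fields\<close>

lemma Der_TD:
  assumes "D \<in> Der_T n f"
  shows "D (T_class n f (p + q)) = D (T_class n f p) \<oplus>\<^bsub>T_ring n f\<^esub> D (T_class n f q)"
    and "D (T_class n f (const2 c * p)) = T_class n f (const2 c) \<otimes>\<^bsub>T_ring n f\<^esub> D (T_class n f p)"
    and "D (T_class n f (p * q)) =
      D (T_class n f p) \<otimes>\<^bsub>T_ring n f\<^esub> T_class n f q \<oplus>\<^bsub>T_ring n f\<^esub> T_class n f p \<otimes>\<^bsub>T_ring n f\<^esub> D (T_class n f q)"
    and "\<exists>u. D (T_class n f p) = T_class n f u"
  using assms PiE_mem[of D "range (T_class n f)" "\<lambda>_. range (T_class n f)" "T_class n f p"]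
  unfolding Der_T_def derivations_def carrier_T_ring
  by (auto simp flip: T_ring_simps)

text \<open>By linearity and the Leibniz rule, a derivation is determined by its values on x1 and
  x2; \<open>g1\<close> and \<open>g2\<close> are arbitrary representatives of these values. The
  Horner form is unfolded first in x1, then in x2.\<close>

lemma Der_T_eq_vector_field:
  assumes D: "D \<in> Der_T n f"
    and x1: "D (T_class n f [:[:0, 1:]:]) = T_class n f g1"
    and x2: "D (T_class n f [:0, 1:]) = T_class n f g2"
  shows "D (T_class n f p) = T_class n f (g1 * D1 p + g2 * D2 p)"
proof -
  note D_simps = Der_TD[OF D]
  obtain u where u: "D (T_class n f 1) = T_class n f u"
    using D_simps(4) by blast
  \<comment> \<open>The Leibniz rule for 1 = 1 * 1; adding the class of \<open>- u\<close> then
    shows that \<open>D\<close> kills 1.\<close>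
  have "T_class n f u = T_class n f (u + u)"
    using D_simps(3)[of 1 1] by (simp add: u)
  then have "T_class n f (u + - u) = T_class n f (u + u + - u)"
    by (simp only: flip: T_ring_simps)
  then have D_1: "D (T_class n f 1) = T_class n f 0"
    by (simp add: u)
  have D_const: "D (T_class n f (const2 c)) = T_class n f 0" for c
    using D_simps(2)[of c 1] by (simp add: D_1)
  have D_inner: "D (T_class n f [:a:]) = T_class n f (g1 * [:pderiv a:])" for a
  proof (induction a)
    case 0
    then show ?case
      using D_const[of 0] by (simp add: const2_def)
  next
    case (pCons c a)
    have "[:pCons c a:] = const2 c + [:[:0, 1:]:] * [:a:]"
      by (simp add: const2_def)
    then show ?case
      using pCons.IH by (simp only: D_simps(1,3) x1 D_const T_ring_simps)
        (simp add: pderiv_pCons smult_add_left algebra_simps)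
  qed
  show ?thesis
  proof (induction p)
    case 0
    then show ?case
      using D_const[of 0] by (simp add: const2_def)
  next
    case (pCons a p)
    have "pCons a p = [:a:] + [:0, 1:] * p"
      by simp
    then have "D (T_class n f (pCons a p)) =
        T_class n f (g1 * [:pderiv a:] + (g2 * p + [:0, 1:] * (g1 * D1 p + g2 * D2 p)))"
      using pCons.IH by (simp only: D_simps(1,3) x2 D_inner T_ring_simps)
    moreover have "g1 * [:pderiv a:] + (g2 * p + [:0, 1:] * (g1 * D1 p + g2 * D2 p)) =
        g1 * D1 (pCons a p) + g2 * D2 (pCons a p)"
    proof -
      have "D1 (pCons a p) = [:pderiv a:] + [:0, 1:] * D1 p"
        by (simp add: D1_pCons)
      moreover have "D2 (pCons a p) = p + [:0, 1:] * D2 p"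
        by (simp add: D2_pCons)
      ultimately show ?thesis
        by (simp only: distrib_left distrib_right mult_ac add_ac)
    qed
    ultimately show ?case
      by simp
  qed
qed

text \<open>The weights are natural numbers, so every polynomial has support in \<open>{0..}\<close>
  and multiplication by it cannot lower the order.\<close>

lemma ideal_wsupp_atLeast: "ideal {p. wsupp w {e..} p} P2"
proof (rule idealI)
  show "ring P2"
    by (rule ring_from_type_algebra)
  then interpret ring P2 .
  show "subgroup {p. wsupp w {e..} p} (add_monoid P2)"
  proof (rule add.subgroupI)
    show "\<ominus>\<^bsub>P2\<^esub> p \<in> {p. wsupp w {e..} p}" if "p \<in> {p. wsupp w {e..} p}" for p
    proof -
      have "\<ominus>\<^bsub>P2\<^esub> p = - p"
        by (rule minus_equality) simp_all
      then show ?thesis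
        using that by (simp add: wsupp_uminus)
    qed
  qed (auto intro: wsupp_add wsupp_0)
  have *: "wsupp w {e..} (p * q)" if "wsupp w {e..} p" for p q
  proof (rule wsupp_mult[OF that])
    show "wsupp w {0..} q"
      by (simp add: wsupp_def)
  qed auto
  show "q \<otimes>\<^bsub>P2\<^esub> p \<in> {p. wsupp w {e..} p}" "p \<otimes>\<^bsub>P2\<^esub> q \<in> {p. wsupp w {e..} p}"
    if "p \<in> {p. wsupp w {e..} p}" for p q
    using that *[of p q] by (simp_all add: mult.commute[of q])
qed

text \<open>Each negative piece must be exactly the zero space, so it has to contain 0. The zero
  polynomial is homogeneous of every degree, negative ones included.\<close>

lemma Der_T_zero_in_Der_graded: "Der_T_zero n f \<in> Der_graded w n f k"
proof -
  have eq: "Der_T_zero n f (T_class n f p) = T_class n f 0" for p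
    by (simp add: Der_T_zero_def carrier_T_ring zero_T_ring)
  have "Der_T_zero n f \<in> carrier (T_ring n f) \<rightarrow>\<^sub>E carrier (T_ring n f)"
    by (auto simp: Der_T_zero_def carrier_T_ring zero_T_ring)
  then have "Der_T_zero n f \<in> Der_T n f"
    by (simp add: Der_T_def derivations_def) (simp add: carrier_T_ring eq)
  moreover have "weighted_homogeneous w e 0" for e
    by (simp add: weighted_homogeneous_eq_wsupp)
  ultimately show ?thesis
    by (auto simp: Der_graded_def T_graded_def eq)
qed

theorem theorem2:
  fixes f :: poly2 and w1 w2 d n :: nat
  assumes "weighted_homogeneous (w1, w2) (int d) f"
    and "isolated_singularity_at_origin f"
    and "d \<ge> 2 * w1" and "2 * w1 \<ge> 2 * w2" and "2 * w2 > 0"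
    and "n \<ge> 3"
  shows "Der_T_nonneg_graded (w1, w2) n f"
proof -
  define w where "w = (w1, w2)"
  have f: "wsupp w {int d} f"
    using assms(1) by (simp add: weighted_homogeneous_eq_wsupp w_def)
  have "fJ_ideal n f \<subseteq> {p. wsupp w {int d..} p}"
    using wsupp_maximal_minors_Jac[OF f[unfolded w_def]] wsupp_mono[OF f] assms(3-6)
    by (intro fJ_ideal_subset ideal_wsupp_atLeast) (auto simp: w_def)
  then have order: "wsupp w {int d..} p" if "p \<in> fJ_ideal n f" for p
    using that by blast
  have "D = Der_T_zero n f" if "k < 0" and D: "D \<in> Der_graded w n f k" for k D
  proof -
    have DT: "D \<in> Der_T n f"
      using D by (simp add: Der_graded_def)
    \<comment> \<open>Values of \<open>D\<close> on homogeneous classes get homogeneous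
      representatives, which makes exact degree comparisons in the polynomial ring possible.\<close>
    have lift: "\<exists>g. D (T_class n f p) = T_class n f g \<and> wsupp w {e + k} g" if "wsupp w {e} p" for p e
    proof -
      have "T_class n f p \<in> T_graded w n f e"
        using that by (auto simp: T_graded_def weighted_homogeneous_eq_wsupp)
      then have "D (T_class n f p) \<in> T_graded w n f (e + k)"
        using D by (auto simp: Der_graded_def)
      then show ?thesis
        by (auto simp: T_graded_def weighted_homogeneous_eq_wsupp)
    qed
    have "wsupp w {int w1} [:[:0, 1:]:]" "wsupp w {int w2} [:0, 1:]"
      by (auto simp: wsupp_def wdeg_def w_def coeff_pCons split: nat.splits)
    from this[THEN lift] obtain g1 g2 where
      g1: "D (T_class n f [:[:0, 1:]:]) = T_class n f g1" "wsupp w {int w1 + k} g1" and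
      g2: "D (T_class n f [:0, 1:]) = T_class n f g2" "wsupp w {int w2 + k} g2"
      by blast
    note D_eq = Der_T_eq_vector_field[OF DT g1(1) g2(1)]
    \<comment> \<open>Since \<open>f\<close> is 0 in the quotient, the field applied to
      \<open>f\<close> lies in the ideal and has order at least d, whereas its degree is d + k <
      d.\<close>
    have "T_class n f f = T_class n f 0"
      by (simp add: T_class_0 T_class_eq_ideal_iff f_in_fJ_ideal)
    then have "T_class n f (g1 * D1 f + g2 * D2 f) = T_class n f 0"
      using D_eq[of f] D_eq[of 0] by simp
    then have "wsupp w {int d..} (g1 * D1 f + g2 * D2 f)"
      by (intro order) (simp add: T_class_0 T_class_eq_ideal_iff)
    moreover have "wsupp w {int d + k} (g1 * D1 f + g2 * D2 f)"
      by (intro wsupp_add wsupp_mult[OF g1(2) wsupp_D1[OF f]] wsupp_mult[OF g2(2) wsupp_D2[OF f]])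
        (simp_all add: w_def)
    ultimately have Df: "g1 * D1 f + g2 * D2 f = 0"
      using \<open>k < 0\<close> by (elim wsupp_disjoint) auto
    define g where "g = map_poly (\<lambda>q. coeff q 0) g1"
    define c where "c = coeff (coeff g2 0) 0"
    \<comment> \<open>A monomial divisible by x1 weighs at least w1 > w1 + k, so \<open>g1\<close>
      involves x2 only.\<close>
    have "coeff (coeff g1 j) i = 0" if "i > 0" for i j
    proof (rule ccontr)
      assume "coeff (coeff g1 j) i \<noteq> 0"
      then have "int (i * w1 + j * w2) = int w1 + k"
        using g1(2) by (simp add: wsupp_def wdeg_def w_def)
      moreover have "w1 \<le> i * w1"
        using that by simp
      ultimately show False
        using \<open>k < 0\<close> by linarith
    qed
    then have g1_eq: "g1 = map_poly (\<lambda>a. [:a:]) g"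
      by (intro poly_eqI) (auto simp: g_def coeff_map_poly coeff_pCons split: nat.splits)
    \<comment> \<open>As w1 \<ge> w2, every nonconstant monomial weighs at least w2 > w2 + k, so
      \<open>g2\<close> is constant.\<close>
    have "coeff (coeff g2 j) i = 0" if "i > 0 \<or> j > 0" for i j
    proof (rule ccontr)
      assume "coeff (coeff g2 j) i \<noteq> 0"
      then have "int (i * w1 + j * w2) = int w2 + k"
        using g2(2) by (simp add: wsupp_def wdeg_def w_def)
      moreover have "w2 \<le> i * w1 + j * w2"
        using that assms(4) by (cases i; cases j) auto
      ultimately show False
        using \<open>k < 0\<close> by linarith
    qed
    then have g2_eq: "g2 = const2 c"
      by (intro poly_eqI) (auto simp: c_def const2_def coeff_pCons split: nat.splits)
    have "g = 0" "c = 0"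
      using annihilating_field_eq_0[OF assms(2) Df[unfolded g1_eq g2_eq]] by simp_all
    then have "D (T_class n f p) = T_class n f 0" for p
      by (simp add: D_eq g1_eq g2_eq const2_def)
    then show ?thesis
      using DT Der_T_zero_in_Der_graded[of n f w k]
      by (intro PiE_ext[of _ "carrier (T_ring n f)" "\<lambda>_. carrier (T_ring n f)"])
        (auto simp: Der_graded_def Der_T_def derivations_def Der_T_zero_def carrier_T_ring zero_T_ring)
  qed
  then show ?thesis
    using Der_T_zero_in_Der_graded unfolding Der_T_nonneg_graded_def w_def by blast
qed

end
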